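(* Let $u:\Omega\to\mathbb{R}$ be the exact solution of the PDE problem, let $\bar z=\mathbb{E}[Z]$ be the clean dataset, let $\eta\ge 0$, and let $\mathcal{A}$ be a data-driven PDE solver which is $\eta$-proper with respect to $\bar z$. Let $\tilde{\mathcal{Z}}_p$ be a $p$-CI for $\bar z$, that is, a random set of datasets (constructed from the random data $Z$) such that $\Pr(\bar z\in\tilde{\mathcal{Z}}_p)\ge p$. Define, for every $x\in\Omega$, $$L(x)=\min_{z\in\tilde{\mathcal{Z}}_p}u_{\mathcal{A}}(x;z)-\eta,\qquad U(x)=\max_{z\in\tilde{\mathcal{Z}}_p}u_{\mathcal{A}}(x;z)+\eta,$$ where these minima and maxima are assumed to exist. Then $(L,U)$ is a joint $p$-CI for $u$ on $\Omega$, i.e. $$\Pr\bigl(L(x)\le u(x)\le U(x)\ \text{ for all } x\in\Omega\bigr)\ge p.$$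
   Context: Setting. Consider a PDE problem $\mathcal{F}[u(x),\lambda(x)]=0$ for $x\in\Omega$, $\mathcal{B}[u(x),\lambda(x)]=b(x)$ for $x\in\Gamma$, where $\Omega$ is a bounded domain with boundary $\Gamma$, $\mathcal{F},\mathcal{B}$ are known deterministic differential operators, the coefficients $\lambda$ are known and deterministic, and $u:\Omega\to\mathbb{R}$ is the (deterministic, fixed) exact solution. Data. A dataset is $z=\{\mathcal{D}_f,\mathcal{D}_b\}$ with $\mathcal{D}_f=\{x_f^i\}_{i=1}^{N_f}\subset\Omega$ and $\mathcal{D}_b=\{(x_b^j,b^j)\}_{j=1}^{N_b}$, $x_b^j\in\Gamma$. Only the values $b^j$ are random: $b^j=b(x_b^j)+\epsilon^j$ with zero-mean noise, $\mathbb{E}[\epsilon^j]=0$ for all $j$; everything else in the dataset is deterministic (so a dataset may be identified with the vector $(b^1,\dots,b^{N_b})$). $Z$ denotes the dataset regarded as a random variable, and the clean (noise-free) dataset is $\bar z=\mathbb{E}[Z]$, a deterministic dataset. Solver. A data-driven PDE solver $\mathcal{A}$ is a map assigning to each dataset $z$ a function $u_{\mathcal{A}}(\cdot\,;z):\Omega\to\mathbb{R}$. It is called $\eta$-proper with respect to $\bar z$ if $\max_{x\in\Omega}|u_{\mathcal{A}}(x;\bar z)-u(x)|\le\eta$. Nothing is assumed about $u_{\mathcal{A}}(\cdot\,;z)$ for $z\ne\bar z$. Confidence interval. A pair of random functions $(L,U)\in\mathbb{R}^{\Omega}\times\mathbb{R}^{\Omega}$ (depending on the random data) is a (joint) $p$-CI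 for $u$ if the random event $\{L(x)\le u(x)\le U(x),\ \forall x\in\Omega\}$ holds with probability at least $p$. *)

theory Defs
  imports "HOL-Probability.Probability"
begin

text \<open>Functions \<open>\<Omega> \<rightarrow> \<real>\<close> (and functions on the closure of \<open>\<Omega>\<close>) are total functions on a Euclidean
  space whose values elsewhere are irrelevant.\<close>

definition is_domain :: "'a::euclidean_space set \<Rightarrow> bool" where
  "is_domain \<Omega> \<longleftrightarrow> open \<Omega> \<and> connected \<Omega> \<and> \<Omega> \<noteq> {}"

text \<open>\<open>iter_deriv S [b\<^sub>1, \<dots>, b\<^sub>n] f\<close> is the iterated partial derivative of \<open>f\<close> in the directions
  \<open>b\<^sub>n\<close>, \dots, \<open>b\<^sub>1\<close>. Derivatives are taken within \<open>S\<close>, so that they make sense at boundary points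
  when \<open>S\<close> is a closed domain, and are the usual ones when \<open>S\<close> is open.\<close>

primrec iter_deriv ::
  "'a::euclidean_space set \<Rightarrow> 'a list \<Rightarrow> ('a \<Rightarrow> 'b::real_normed_vector) \<Rightarrow> 'a \<Rightarrow> 'b" where
  "iter_deriv S [] f = f"
| "iter_deriv S (b # bs) f = (\<lambda>x. frechet_derivative (iter_deriv S bs f) (at x within S) b)"

definition times_differentiable_on ::
  "nat \<Rightarrow> ('a::euclidean_space \<Rightarrow> 'b::real_normed_vector) \<Rightarrow> 'a set \<Rightarrow> bool" where
  "times_differentiable_on k f S \<longleftrightarrow>
     (\<forall>bs. set bs \<subseteq> Basis \<and> length bs < k \<longrightarrow> iter_deriv S bs f differentiable_on S)"

definition jet ::
  "nat \<Rightarrow> 'a::euclidean_space set \<Rightarrow> ('a \<Rightarrow> 'b::real_normed_vector) \<Rightarrow> 'a \<Rightarrow> 'a list \<Rightarrow> 'b" where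
  "jet k S f x = (\<lambda>bs. if set bs \<subseteq> Basis \<and> length bs \<le> k then iter_deriv S bs f x else 0)"

text \<open>A (possibly nonlinear) differential operator on \<open>X\<close>, of some finite order \<open>k\<close>: on functions
  that are \<open>k\<close> times differentiable on \<open>S\<close>, the value of \<open>D[v,\<mu>]\<close> at \<open>x \<in> X\<close> is a function of \<open>x\<close> and of
  the derivatives of \<open>v\<close> and \<open>\<mu>\<close> at \<open>x\<close> of order at most \<open>k\<close>. The operator in the interior is used
  with \<open>S = X = \<Omega>\<close>, the boundary operator with \<open>S = closure \<Omega>\<close> and \<open>X = frontier \<Omega>\<close>.\<close>

definition differential_operator ::
  "'a::euclidean_space set \<Rightarrow> 'a set \<Rightarrow>
   (('a \<Rightarrow> real) \<Rightarrow> ('a \<Rightarrow> 'c::real_normed_vector) \<Rightarrow> 'a \<Rightarrow> 'd) \<Rightarrow> bool" where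
  "differential_operator S X D \<longleftrightarrow>
     (\<exists>k G. \<forall>v \<mu>. times_differentiable_on k v S \<and> times_differentiable_on k \<mu> S \<longrightarrow>
        (\<forall>x\<in>X. D v \<mu> x = G x (jet k S v x) (jet k S \<mu> x)))"

definition exact_solution ::
  "'a::euclidean_space set \<Rightarrow>
   (('a \<Rightarrow> real) \<Rightarrow> ('a \<Rightarrow> 'c) \<Rightarrow> 'a \<Rightarrow> 'd::zero) \<Rightarrow>
   (('a \<Rightarrow> real) \<Rightarrow> ('a \<Rightarrow> 'c) \<Rightarrow> 'a \<Rightarrow> real) \<Rightarrow>
   ('a \<Rightarrow> 'c) \<Rightarrow> ('a \<Rightarrow> real) \<Rightarrow> ('a \<Rightarrow> real) \<Rightarrow> bool" where
  "exact_solution \<Omega> F B lam b u \<longleftrightarrow>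
     (\<forall>x\<in>\<Omega>. F u lam x = 0) \<and> (\<forall>x\<in>frontier \<Omega>. B u lam x = b x)"

text \<open>A dataset \<open>(D\<^sub>f, D\<^sub>b)\<close> consists of the interior points \<open>x\<^sub>f\<^sup>i\<close> and of the pairs \<open>(x\<^sub>b\<^sup>j, b\<^sup>j)\<close>.\<close>

type_synonym 'a dataset = "'a list \<times> ('a \<times> real) list"

definition datasets :: "'a::euclidean_space set \<Rightarrow> 'a dataset set" where
  "datasets \<Omega> = {(Df, Db). set Df \<subseteq> \<Omega> \<and> fst ` set Db \<subseteq> frontier \<Omega>}"

definition dataset_of :: "'a list \<Rightarrow> 'a list \<Rightarrow> (nat \<Rightarrow> real) \<Rightarrow> 'a dataset" where
  "dataset_of xf xb v = (xf, map (\<lambda>j. (xb ! j, v j)) [0..<length xb])"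

text \<open>Only the values at the boundary points are random, so \<open>\<E>[Z]\<close> replaces each of them by its
  expectation.\<close>

definition random_dataset ::
  "'a list \<Rightarrow> 'a list \<Rightarrow> (nat \<Rightarrow> 'w \<Rightarrow> real) \<Rightarrow> 'w \<Rightarrow> 'a dataset" where
  "random_dataset xf xb bobs \<omega> = dataset_of xf xb (\<lambda>j. bobs j \<omega>)"

definition expected_dataset ::
  "'w measure \<Rightarrow> 'a list \<Rightarrow> 'a list \<Rightarrow> (nat \<Rightarrow> 'w \<Rightarrow> real) \<Rightarrow> 'a dataset" where
  "expected_dataset M xf xb bobs = dataset_of xf xb (\<lambda>j. integral\<^sup>L M (bobs j))"

text \<open>\<open>\<Omega>\<close> is open, so the maximum of the error is read as a supremum, which need not be attained.\<close>

definition proper_solver ::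
  "real \<Rightarrow> 'a set \<Rightarrow> ('a \<Rightarrow> real) \<Rightarrow> ('z \<Rightarrow> 'a \<Rightarrow> real) \<Rightarrow> 'z \<Rightarrow> bool" where
  "proper_solver \<eta> \<Omega> u uA zbar \<longleftrightarrow>
     bdd_above ((\<lambda>x. \<bar>uA zbar x - u x\<bar>) ` \<Omega>) \<and> (SUP x\<in>\<Omega>. \<bar>uA zbar x - u x\<bar>) \<le> \<eta>"

text \<open>\<open>P\<close> holds with probability at least \<open>p\<close>. An event such as \<open>\<forall>x\<in>\<Omega>. L x \<le> u x \<and> u x \<le> U x\<close>
  is an uncountable intersection and need not be measurable, hence the inner probability; see
  \<open>prob_at_least_iff\<close> for the measurable case.\<close>

definition prob_at_least :: "'w measure \<Rightarrow> real \<Rightarrow> ('w \<Rightarrow> bool) \<Rightarrow> bool" where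
  "prob_at_least M p P \<longleftrightarrow> (\<exists>E\<in>sets M. E \<subseteq> {\<omega>\<in>space M. P \<omega>} \<and> p \<le> measure M E)"

lemma (in finite_measure) prob_at_least_iff:
  assumes "{\<omega>\<in>space M. P \<omega>} \<in> sets M"
  shows "prob_at_least M p P \<longleftrightarrow> p \<le> measure M {\<omega>\<in>space M. P \<omega>}"
  unfolding prob_at_least_def using assms by (meson finite_measure_mono order.trans order_refl)

definition random_set_CI :: "'w measure \<Rightarrow> real \<Rightarrow> 'z \<Rightarrow> ('w \<Rightarrow> 'z set) \<Rightarrow> bool" where
  "random_set_CI M p zbar C \<longleftrightarrow> prob_at_least M p (\<lambda>\<omega>. zbar \<in> C \<omega>)"

definition joint_CI ::
  "'w measure \<Rightarrow> real \<Rightarrow> 'a set \<Rightarrow> ('a \<Rightarrow> real) \<Rightarrow> ('w \<Rightarrow> 'a \<Rightarrow> real) \<Rightarrow> ('w \<Rightarrow> 'a \<Rightarrow> real) \<Rightarrow> bool" where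
  "joint_CI M p \<Omega> u L U \<longleftrightarrow> prob_at_least M p (\<lambda>\<omega>. \<forall>x\<in>\<Omega>. L \<omega> x \<le> u x \<and> u x \<le> U \<omega> x)"

text \<open>\<open>LEAST\<close> and \<open>GREATEST\<close> give the minimum and the maximum of a possibly infinite set, provided
  that these exist.\<close>

definition has_minimum :: "real set \<Rightarrow> bool" where
  "has_minimum S \<longleftrightarrow> (\<exists>m\<in>S. \<forall>y\<in>S. m \<le> y)"

definition has_maximum :: "real set \<Rightarrow> bool" where
  "has_maximum S \<longleftrightarrow> (\<exists>m\<in>S. \<forall>y\<in>S. y \<le> m)"

definition CI_lower :: "('z \<Rightarrow> 'a \<Rightarrow> real) \<Rightarrow> real \<Rightarrow> 'z set \<Rightarrow> 'a \<Rightarrow> real" where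
  "CI_lower uA \<eta> C x = (LEAST v. v \<in> (\<lambda>z. uA z x) ` C) - \<eta>"

definition CI_upper :: "('z \<Rightarrow> 'a \<Rightarrow> real) \<Rightarrow> real \<Rightarrow> 'z set \<Rightarrow> 'a \<Rightarrow> real" where
  "CI_upper uA \<eta> C x = (GREATEST v. v \<in> (\<lambda>z. uA z x) ` C) + \<eta>"

end

theory Submission
  imports Defs
begin

text \<open>On the event that \<open>zbar\<close> lies in \<open>Zset (Z \<omega>)\<close>, the
  value \<open>uA zbar x\<close> is one of those over which the minimum and the maximum at
  \<open>x\<close> are taken, so it lies between them (\<open>CI_lower_le\<close>,
  \<open>CI_upper_ge\<close>). Properness puts \<open>u x\<close> within \<open>\<eta>\<close> of
  \<open>uA zbar x\<close>, and widening both ends by \<open>\<eta>\<close> absorbs this error. The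
  event does not depend on \<open>x\<close>, so it gives coverage at all points of
  \<open>\<Omega>\<close> at once, without a union bound, and its probability carries over by
  \<open>prob_at_least_mono\<close>.\<close>

text \<open>The measurable set that witnesses the bound for \<open>P\<close> is also a witness for
  \<open>Q\<close>. As the probability is an inner one, \<open>Q\<close> itself need not define a
  measurable event.\<close>

lemma prob_at_least_mono:
  assumes "prob_at_least M p P"
    and "\<And>\<omega>. \<omega> \<in> space M \<Longrightarrow> P \<omega> \<Longrightarrow> Q \<omega>"
  shows "prob_at_least M p Q"
  using assms unfolding prob_at_least_def by blast

text \<open>The \<open>bdd_above\<close> part of \<open>proper_solver\<close> is what makes the
  real-valued \<open>SUP\<close> a genuine upper bound of the pointwise errors.\<close>

lemma proper_solver_error_le:
  assumes "proper_solver \<eta> \<Omega> u uA z" and "x \<in> \<Omega>"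
  shows "\<bar>uA z x - u x\<bar> \<le> \<eta>"
  using assms unfolding proper_solver_def by (meson cSUP_upper order.trans)

text \<open>\<open>LEAST\<close> on the reals is meaningful only if a minimum is attained;
  \<open>has_minimum\<close> supplies one, and \<open>Least_equality\<close> identifies it with the
  \<open>LEAST\<close> value.\<close>

lemma CI_lower_le:
  assumes "has_minimum ((\<lambda>z. uA z x) ` C)" and "z \<in> C"
  shows "CI_lower uA \<eta> C x \<le> uA z x - \<eta>"
proof -
  obtain m where m: "m \<in> (\<lambda>z. uA z x) ` C" "\<And>y. y \<in> (\<lambda>z. uA z x) ` C \<Longrightarrow> m \<le> y"
    using assms(1) unfolding has_minimum_def by blast
  then have "(LEAST v. v \<in> (\<lambda>z. uA z x) ` C) = m"
    by (rule Least_equality)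
  then show ?thesis
    using m(2)[of "uA z x"] assms(2) by (simp add: CI_lower_def)
qed

lemma CI_upper_ge:
  assumes "has_maximum ((\<lambda>z. uA z x) ` C)" and "z \<in> C"
  shows "uA z x + \<eta> \<le> CI_upper uA \<eta> C x"
proof -
  obtain m where m: "m \<in> (\<lambda>z. uA z x) ` C" "\<And>y. y \<in> (\<lambda>z. uA z x) ` C \<Longrightarrow> y \<le> m"
    using assms(1) unfolding has_maximum_def by blast
  then have "(GREATEST v. v \<in> (\<lambda>z. uA z x) ` C) = m"
    by (rule Greatest_equality)
  then show ?thesis
    using m(2)[of "uA z x"] assms(2) by (simp add: CI_upper_def)
qed

theorem theorem4p1:
  fixes \<Omega> :: "'a::euclidean_space set"
    and F :: "('a \<Rightarrow> real) \<Rightarrow> ('a \<Rightarrow> 'c::real_normed_vector) \<Rightarrow> 'a \<Rightarrow> 'd::real_normed_vector"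
    and B :: "('a \<Rightarrow> real) \<Rightarrow> ('a \<Rightarrow> 'c) \<Rightarrow> 'a \<Rightarrow> real"
    and lam :: "'a \<Rightarrow> 'c" and b u :: "'a \<Rightarrow> real"
    and M :: "'w measure"
    and xf xb :: "'a list"
    and noise bobs :: "nat \<Rightarrow> 'w \<Rightarrow> real"
    and Z :: "'w \<Rightarrow> 'a dataset" and zbar :: "'a dataset"
    and uA :: "'a dataset \<Rightarrow> 'a \<Rightarrow> real"
    and Zset :: "'a dataset \<Rightarrow> 'a dataset set"
    and \<eta> p :: real
  assumes "is_domain \<Omega>" and "bounded \<Omega>"
    and "differential_operator \<Omega> \<Omega> F"
    and "differential_operator (closure \<Omega>) (frontier \<Omega>) B"
    and "exact_solution \<Omega> F B lam b u"
    and "prob_space M"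
    and "set xf \<subseteq> \<Omega>" and "set xb \<subseteq> frontier \<Omega>"
    and "\<And>j. j < length xb \<Longrightarrow> integrable M (noise j)"
    and "\<And>j. j < length xb \<Longrightarrow> integral\<^sup>L M (noise j) = 0"
    and "\<And>j \<omega>. bobs j \<omega> = b (xb ! j) + noise j \<omega>"
    and "Z = random_dataset xf xb bobs"
    and "zbar = expected_dataset M xf xb bobs"
    and "\<eta> \<ge> 0"
    and "proper_solver \<eta> \<Omega> u uA zbar"
    and "\<And>\<omega>. \<omega> \<in> space M \<Longrightarrow> Zset (Z \<omega>) \<subseteq> datasets \<Omega>"
    and "random_set_CI M p zbar (\<lambda>\<omega>. Zset (Z \<omega>))"
    and "\<And>\<omega> x. \<omega> \<in> space M \<Longrightarrow> x \<in> \<Omega> \<Longrightarrow> has_minimum ((\<lambda>z. uA z x) ` Zset (Z \<omega>))"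
    and "\<And>\<omega> x. \<omega> \<in> space M \<Longrightarrow> x \<in> \<Omega> \<Longrightarrow> has_maximum ((\<lambda>z. uA z x) ` Zset (Z \<omega>))"
  shows "joint_CI M p \<Omega> u (\<lambda>\<omega>. CI_lower uA \<eta> (Zset (Z \<omega>))) (\<lambda>\<omega>. CI_upper uA \<eta> (Zset (Z \<omega>)))"
  unfolding joint_CI_def
proof (rule prob_at_least_mono)
  \<comment> \<open>This fixes the premise event that the rule left schematic: the coverage of the
    clean dataset.\<close>
  show "prob_at_least M p (\<lambda>\<omega>. zbar \<in> Zset (Z \<omega>))"
    using assms(17) unfolding random_set_CI_def .
next
  fix \<omega> assume \<omega>: "\<omega> \<in> space M" and z: "zbar \<in> Zset (Z \<omega>)"
  show "\<forall>x\<in>\<Omega>. CI_lower uA \<eta> (Zset (Z \<omega>)) x \<le> u x \<and> u x \<le> CI_upper uA \<eta> (Zset (Z \<omega>)) x"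
  proof
    fix x assume x: "x \<in> \<Omega>"
    have "\<bar>uA zbar x - u x\<bar> \<le> \<eta>"
      using assms(15) x by (rule proper_solver_error_le)
    moreover have "CI_lower uA \<eta> (Zset (Z \<omega>)) x \<le> uA zbar x - \<eta>"
      using assms(18)[OF \<omega> x] z by (rule CI_lower_le)
    moreover have "uA zbar x + \<eta> \<le> CI_upper uA \<eta> (Zset (Z \<omega>)) x"
      using assms(19)[OF \<omega> x] z by (rule CI_upper_ge)
    ultimately show "CI_lower uA \<eta> (Zset (Z \<omega>)) x \<le> u x \<and> u x \<le> CI_upper uA \<eta> (Zset (Z \<omega>)) x"
      \<comment> \<open>The chain is lower end \<le> \<open>uA zbar x - \<eta>\<close> \<le>
        \<open>u x\<close> \<le> \<open>uA zbar x + \<eta>\<close> \<le> upper end.\<close>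
      by linarith
  qed
qed

end
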